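(* Let $\mu$ be a Symmetric Rank Covariance (for pairs of random vectors $X\in\mathbb{R}^r$, $Y\in\mathbb{R}^s$). Then: (a) $\mu$ is nonparametric: for all strictly increasing functions $f_1,\dots,f_r,g_1,\dots,g_s:\mathbb{R}\to\mathbb{R}$, $\mu(X,Y)=\mu\bigl((f_1(X_1),\dots,f_r(X_r)),(g_1(Y_1),\dots,g_s(Y_s))\bigr)$. (b) $\mu$ is I-consistent: if $X$ and $Y$ are independent then $\mu(X,Y)=0$. (c) If $\nu$ is another Symmetric Rank Covariance (for the same dimensions $r,s$), then the product $\mu\nu$, i.e. $(X,Y)\mapsto\mu(X,Y)\nu(X,Y)$, is a Symmetric Rank Covariance.
   Context: Notation: $w^{[m]}=(w^1,\dots,w^m)\in\mathbb{R}^{d\times m}$ with $w^j\in\mathbb{R}^d$. For $\sigma\in S_m$, $w^{\sigma[m]}=(w^{\sigma^{-1}(1)},\dots,w^{\sigma^{-1}(m)})$. Joint rank matrix: $\mathcal{R}(w^{[m]})_{ij}=1+\sum_{k=1}^m 1_{[w^k_i<w^j_i]}$. A rank indicator function of order $m$ and dimension $d$ is a function $I:\mathbb{R}^{d\times m}\to\{0,1\}$ with $I(\mathcal{R}(w^{[m]}))=I(w^{[m]})$ for all $w^{[m]}$. Symmetric Rank Covariance: let $I_X,I_Y$ be rank indicator functions of equal order $m$ and dimensions $r,s$, and $H\le S_m$ a subgroup with an equal number of even and odd permutations. With $(X^1,Y^1),(X^2,Y^2),\dots$ i.i.d. copies of $(X,Y)$, $$\mu_{I_X,I_Y,H}(X,Y)=E\Big[\Big(\sum_{\sigma\in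 H}\mathrm{sign}(\sigma)I_X(X^{\sigma[m]})\Big)\Big(\sum_{\sigma\in H}\mathrm{sign}(\sigma)I_Y(Y^{\sigma[m]})\Big)\Big].$$ A measure of dependence $\mu$ is a Symmetric Rank Covariance if $\mu=c\,\mu_{I_X,I_Y,H}$ for some scalar $c>0$ and such a triple $(I_X,I_Y,H)$. *)

theory Defs
  imports "HOL-Probability.Probability" "HOL-Algebra.Sym_Groups"
begin

(* A point w^[m] of R^(d x m) is a family w :: nat => real^'d with index set {1..m},
   kept extensional (undefined outside {1..m}) so that it corresponds to exactly
   one m-tuple. *)

definition tuples :: "nat \<Rightarrow> (nat \<Rightarrow> real ^ 'd) set" where
  "tuples m = ({1..m} \<rightarrow>\<^sub>E UNIV)"

definition permute_tuple ::
    "nat \<Rightarrow> (nat \<Rightarrow> nat) \<Rightarrow> (nat \<Rightarrow> real ^ 'd) \<Rightarrow> (nat \<Rightarrow> real ^ 'd)" where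
  "permute_tuple m \<sigma> w = (\<lambda>j\<in>{1..m}. w (inv_into UNIV \<sigma> j))"

definition joint_rank :: "nat \<Rightarrow> (nat \<Rightarrow> real ^ 'd) \<Rightarrow> (nat \<Rightarrow> real ^ 'd)" where
  "joint_rank m w =
     (\<lambda>j\<in>{1..m}. \<chi> i. 1 + (\<Sum>k=1..m. of_bool (w k $ i < w j $ i)))"

definition rank_indicator :: "nat \<Rightarrow> ((nat \<Rightarrow> real ^ 'd) \<Rightarrow> real) \<Rightarrow> bool" where
  "rank_indicator m I \<longleftrightarrow>
     (\<forall>w\<in>tuples m. I w \<in> {0, 1} \<and> I (joint_rank m w) = I w)"

definition balanced_subgroup :: "nat \<Rightarrow> (nat \<Rightarrow> nat) set \<Rightarrow> bool" where
  "balanced_subgroup m H \<longleftrightarrow>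
     subgroup H (sym_group m) \<and>
     card {\<sigma> \<in> H. evenperm \<sigma>} = card {\<sigma> \<in> H. \<not> evenperm \<sigma>}"

definition signed_sum ::
    "nat \<Rightarrow> (nat \<Rightarrow> nat) set \<Rightarrow> ((nat \<Rightarrow> real ^ 'd) \<Rightarrow> real) \<Rightarrow> (nat \<Rightarrow> real ^ 'd) \<Rightarrow> real" where
  "signed_sum m H I w = (\<Sum>\<sigma>\<in>H. of_int (sign \<sigma>) * I (permute_tuple m \<sigma> w))"

definition joint_law ::
    "'a measure \<Rightarrow> ('a \<Rightarrow> real ^ 'r) \<Rightarrow> ('a \<Rightarrow> real ^ 's) \<Rightarrow> ((real ^ 'r) \<times> (real ^ 's)) measure" where
  "joint_law M X Y = distr M borel (\<lambda>\<omega>. (X \<omega>, Y \<omega>))"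

(* prob_space.indep_var requires both variables to have the same range type, so it does
   not apply to vectors of different dimensions; this is independence of the
   sigma-algebras generated by X and Y. *)

definition indep_vectors ::
    "'a measure \<Rightarrow> ('a \<Rightarrow> real ^ 'r) \<Rightarrow> ('a \<Rightarrow> real ^ 's) \<Rightarrow> bool" where
  "indep_vectors M X Y \<longleftrightarrow>
     prob_space.indep_set M {X -` A \<inter> space M |A. A \<in> sets borel}
                            {Y -` B \<inter> space M |B. B \<in> sets borel}"

(* The expectation over i.i.d. copies depends on (X, Y) only through its joint law L.
   The copies used here are the coordinates of the product space L^m; lemma
   src_iid_copies below shows that any i.i.d. copies give the same value. *)

definition src ::
    "nat \<Rightarrow> ((nat \<Rightarrow> real ^ 'r) \<Rightarrow> real) \<Rightarrow> ((nat \<Rightarrow> real ^ 's) \<Rightarrow> real) \<Rightarrow> (nat \<Rightarrow> nat) set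
       \<Rightarrow> ((real ^ 'r) \<times> (real ^ 's)) measure \<Rightarrow> real" where
  "src m I\<^sub>X I\<^sub>Y H L =
     (LINT z | Pi\<^sub>M {1..m} (\<lambda>_. L).
        signed_sum m H I\<^sub>X (\<lambda>j\<in>{1..m}. fst (z j)) *
        signed_sum m H I\<^sub>Y (\<lambda>j\<in>{1..m}. snd (z j)))"

(* A measure of dependence is a real functional of the joint law; its value at random
   vectors X, Y on M is mu (joint_law M X Y).  Only its values at Borel probability
   measures are meaningful, hence the guard. *)

definition symmetric_rank_covariance ::
    "(((real ^ 'r) \<times> (real ^ 's)) measure \<Rightarrow> real) \<Rightarrow> bool" where
  "symmetric_rank_covariance \<mu> \<longleftrightarrow>
     (\<exists>c m I\<^sub>X I\<^sub>Y H.
        c > 0 \<and> rank_indicator m I\<^sub>X \<and> rank_indicator m I\<^sub>Y \<and> balanced_subgroup m H \<and>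
        (\<forall>L. prob_space L \<and> sets L = sets borel \<longrightarrow> \<mu> L = c * src m I\<^sub>X I\<^sub>Y H L))"

lemma joint_rank_measurable:
  fixes F :: "nat \<Rightarrow> 'b \<Rightarrow> real ^ 'd::finite"
  assumes F: "\<And>j. j \<in> {1..m} \<Longrightarrow> F j \<in> borel_measurable M"
  shows "(\<lambda>x. joint_rank m (\<lambda>j\<in>{1..m}. F j x)) \<in> measurable M (count_space UNIV)"
proof -
  define B where "B = (\<lambda>x. {(k, j, i). k \<in> {1..m} \<and> j \<in> {1..m} \<and> F k x $ i < F j x $ i})"
  let ?U = "{1..m} \<times> {1..m} \<times> (UNIV :: 'd set)"
  have nth: "(\<lambda>v :: real ^ 'd. v $ i) \<in> borel_measurable borel" for i
    by (intro borel_measurable_continuous_onI continuous_on_component continuous_on_id)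
  have "B \<in> measurable M (count_space (Pow ?U))"
  proof (subst measurable_count_space_eq2)
    show "finite (Pow ?U)" by simp
    have "B -` {A} \<inter> space M \<in> sets M" if A: "A \<subseteq> ?U" for A
    proof -
      have BU: "B x \<subseteq> ?U" for x
        unfolding B_def by auto
      have "B -` {A} \<inter> space M = {x \<in> space M. \<forall>p \<in> ?U. (p \<in> B x) = (p \<in> A)}"
      proof (rule Set.set_eqI)
        fix x
        have "B x = A \<longleftrightarrow> (\<forall>p \<in> ?U. (p \<in> B x) = (p \<in> A))"
          using A BU[of x] by blast
        then show "x \<in> B -` {A} \<inter> space M \<longleftrightarrow>
            x \<in> {x \<in> space M. \<forall>p \<in> ?U. (p \<in> B x) = (p \<in> A)}"
          by (simp only: vimage_eq singleton_iff Int_iff mem_Collect_eq) blast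
      qed
      also have "\<dots> \<in> sets M"
      proof (rule sets.sets_Collect_finite_All)
        fix p assume p: "p \<in> ?U"
        obtain k j i where pe: "p = (k, j, i)" by (cases p)
        have pB: "p \<in> B x \<longleftrightarrow> F k x $ i < F j x $ i" for x
          using p unfolding pe B_def by simp
        have m: "F k \<in> borel_measurable M" "F j \<in> borel_measurable M" using p pe F by auto
        have "(\<lambda>x. F k x $ i) \<in> borel_measurable M" "(\<lambda>x. F j x $ i) \<in> borel_measurable M"
          by (rule measurable_compose[OF m(1) nth] measurable_compose[OF m(2) nth])+
        then have "{x \<in> space M. F k x $ i < F j x $ i} \<in> sets M"
          by (rule borel_measurable_less)
        then have "{x \<in> space M. (F k x $ i < F j x $ i) = (p \<in> A)} \<in> sets M"
          by (cases "p \<in> A") (auto intro: sets.sets_Collect_neg)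
        then show "{x \<in> space M. (p \<in> B x) = (p \<in> A)} \<in> sets M"
          by (simp only: pB)
      qed simp
      finally show ?thesis .
    qed
    then show "B \<in> space M \<rightarrow> Pow ?U \<and> (\<forall>A\<in>Pow ?U. B -` {A} \<inter> space M \<in> sets M)"
      unfolding B_def by auto
  qed
  then have B: "(\<lambda>x. \<lambda>j\<in>{1..m}. (\<chi> i. 1 + (\<Sum>k=1..m. of_bool ((k, j, i) \<in> B x))) :: real ^ 'd)
      \<in> measurable M (count_space UNIV)"
    by (rule measurable_compose) auto
  have "joint_rank m (\<lambda>j\<in>{1..m}. F j x) =
      (\<lambda>j\<in>{1..m}. \<chi> i. 1 + (\<Sum>k=1..m. of_bool ((k, j, i) \<in> B x)))" for x
    unfolding joint_rank_def
  proof (rule restrict_ext)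
    fix j assume "j \<in> {1..m}"
    then have "(\<Sum>k=1..m. of_bool ((\<lambda>j\<in>{1..m}. F j x) k $ i < (\<lambda>j\<in>{1..m}. F j x) j $ i)) =
        (\<Sum>k=1..m. of_bool ((k, j, i) \<in> B x) :: real)" for i
      by (intro sum.cong refl) (simp add: B_def)
    then show "(\<chi> i. 1 + (\<Sum>k=1..m. of_bool ((\<lambda>j\<in>{1..m}. F j x) k $ i < (\<lambda>j\<in>{1..m}. F j x) j $ i))) =
        ((\<chi> i. 1 + (\<Sum>k=1..m. of_bool ((k, j, i) \<in> B x))) :: real ^ 'd)"
      by (simp only:)
  qed
  with B show ?thesis by simp
qed

lemma signed_sum_measurable:
  fixes F :: "nat \<Rightarrow> 'b \<Rightarrow> real ^ 'd::finite"
  assumes I: "rank_indicator m I" and H: "balanced_subgroup m H"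
    and F: "\<And>j. j \<in> {1..m} \<Longrightarrow> F j \<in> borel_measurable M"
  shows "(\<lambda>x. signed_sum m H I (\<lambda>j\<in>{1..m}. F j x)) \<in> borel_measurable M"
  unfolding signed_sum_def
proof (intro borel_measurable_sum borel_measurable_times borel_measurable_const)
  fix \<sigma> assume "\<sigma> \<in> H"
  with H have perm: "\<sigma> permutes {1..m}"
    using subgroup.subset[of H "sym_group m"]
    by (auto simp: balanced_subgroup_def sym_group_def)
  then have inv: "inv_into UNIV \<sigma> j \<in> {1..m}" if "j \<in> {1..m}" for j
    using that permutes_in_image[OF permutes_inv[OF perm]] by simp
  have eq: "permute_tuple m \<sigma> (\<lambda>j\<in>{1..m}. F j x) = (\<lambda>j\<in>{1..m}. F (inv_into UNIV \<sigma> j) x)" for x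
    unfolding permute_tuple_def using inv by (auto simp: fun_eq_iff)
  have "I (permute_tuple m \<sigma> (\<lambda>j\<in>{1..m}. F j x)) =
      I (joint_rank m (\<lambda>j\<in>{1..m}. F (inv_into UNIV \<sigma> j) x))" for x
  proof -
    have "(\<lambda>j\<in>{1..m}. F (inv_into UNIV \<sigma> j) x) \<in> tuples m"
      unfolding tuples_def by (rule restrict_PiE_iff[THEN iffD2]) blast
    then show ?thesis
      using I unfolding eq rank_indicator_def by metis
  qed
  moreover have "(\<lambda>x. I (joint_rank m (\<lambda>j\<in>{1..m}. F (inv_into UNIV \<sigma> j) x))) \<in> borel_measurable M"
    by (rule measurable_compose[OF joint_rank_measurable]) (use F inv in auto)
  ultimately show "(\<lambda>x. I (permute_tuple m \<sigma> (\<lambda>j\<in>{1..m}. F j x))) \<in> borel_measurable M"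
    by simp
qed

lemma src_iid_copies:
  fixes X :: "'a \<Rightarrow> real ^ 'r::finite" and Y :: "'a \<Rightarrow> real ^ 's::finite"
    and Xc :: "nat \<Rightarrow> 'b \<Rightarrow> real ^ 'r" and Yc :: "nat \<Rightarrow> 'b \<Rightarrow> real ^ 's"
  assumes N: "prob_space N"
    and IX: "rank_indicator m I\<^sub>X" and IY: "rank_indicator m I\<^sub>Y" and H: "balanced_subgroup m H"
    and indep: "prob_space.indep_vars N (\<lambda>_. borel) (\<lambda>j \<omega>. (Xc j \<omega>, Yc j \<omega>)) {1..m}"
    and copies: "\<And>j. j \<in> {1..m} \<Longrightarrow> joint_law N (Xc j) (Yc j) = joint_law M X Y"
  shows "src m I\<^sub>X I\<^sub>Y H (joint_law M X Y) =
     (LINT \<omega> | N. signed_sum m H I\<^sub>X (\<lambda>j\<in>{1..m}. Xc j \<omega>) *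
                  signed_sum m H I\<^sub>Y (\<lambda>j\<in>{1..m}. Yc j \<omega>))"
proof (cases "m = 0")
  case True
  have "{1..m} = {}" using True by simp
  then show ?thesis
    using prob_space.prob_space[OF N]
    by (simp only: src_def restrict_def PiM_empty lebesgue_integral_count_space_finite
        lebesgue_integral_const empty_iff if_False) simp
next
  case False
  interpret N: prob_space N by (rule N)
  let ?Z = "\<lambda>j \<omega>. (Xc j \<omega>, Yc j \<omega>)" and ?L = "joint_law M X Y"
  have rv: "\<And>j. j \<in> {1..m} \<Longrightarrow> ?Z j \<in> measurable N borel"
    using indep by (auto simp: N.indep_vars_def)
  have "distr N (Pi\<^sub>M {1..m} (\<lambda>_. borel)) (\<lambda>\<omega>. \<lambda>j\<in>{1..m}. ?Z j \<omega>) =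
      Pi\<^sub>M {1..m} (\<lambda>j. distr N borel (?Z j))"
    using N.indep_vars_iff_distr_eq_PiM'[of "{1..m}" ?Z "\<lambda>_. borel"] indep rv False by auto
  also have "\<dots> = Pi\<^sub>M {1..m} (\<lambda>_. ?L)"
    by (rule PiM_cong) (use copies in \<open>auto simp: joint_law_def\<close>)
  finally have PiL: "Pi\<^sub>M {1..m} (\<lambda>_. ?L) =
      distr N (Pi\<^sub>M {1..m} (\<lambda>_. borel)) (\<lambda>\<omega>. \<lambda>j\<in>{1..m}. ?Z j \<omega>)" by simp
  have Zm: "(\<lambda>\<omega>. \<lambda>j\<in>{1..m}. ?Z j \<omega>) \<in> measurable N (Pi\<^sub>M {1..m} (\<lambda>_. borel))"
    by (rule measurable_restrict) (rule rv)
  have proj: "(\<lambda>z. fst (z j)) \<in> borel_measurable (Pi\<^sub>M {1..m} (\<lambda>_. borel :: ((real ^ 'r) \<times> (real ^ 's)) measure))"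
    "(\<lambda>z. snd (z j)) \<in> borel_measurable (Pi\<^sub>M {1..m} (\<lambda>_. borel :: ((real ^ 'r) \<times> (real ^ 's)) measure))"
    if "j \<in> {1..m}" for j
    using that by (auto intro!: measurable_compose[OF measurable_component_singleton]
        borel_measurable_continuous_onI continuous_intros)
  have "(LINT z | Pi\<^sub>M {1..m} (\<lambda>_. ?L).
        signed_sum m H I\<^sub>X (\<lambda>j\<in>{1..m}. fst (z j)) *
        signed_sum m H I\<^sub>Y (\<lambda>j\<in>{1..m}. snd (z j))) =
     (LINT \<omega> | N. signed_sum m H I\<^sub>X (\<lambda>j\<in>{1..m}. fst ((\<lambda>j\<in>{1..m}. ?Z j \<omega>) j)) *
                  signed_sum m H I\<^sub>Y (\<lambda>j\<in>{1..m}. snd ((\<lambda>j\<in>{1..m}. ?Z j \<omega>) j)))"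
    unfolding PiL
    by (rule integral_distr[OF Zm])
       (intro borel_measurable_times signed_sum_measurable[OF IX H] signed_sum_measurable[OF IY H] proj)
  moreover have "(\<lambda>j\<in>{1..m}. fst ((\<lambda>j\<in>{1..m}. ?Z j \<omega>) j)) = (\<lambda>j\<in>{1..m}. Xc j \<omega>)"
    "(\<lambda>j\<in>{1..m}. snd ((\<lambda>j\<in>{1..m}. ?Z j \<omega>) j)) = (\<lambda>j\<in>{1..m}. Yc j \<omega>)" for \<omega>
    by (auto simp: fun_eq_iff)
  ultimately show ?thesis
    unfolding src_def by (simp only:)
qed

end

(* A rank indicator sees only the coordinatewise order of its arguments, so strictly increasing
   maps leave the integrand of the covariance unchanged.  If X and Y are independent, the m i.i.d.
   copies of (X, Y) are distributed like an i.i.d. tuple of X's paired with an independent i.i.d.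
   tuple of Y's; the X-factor then integrates to 0, because an i.i.d. tuple is exchangeable and
   the signs of H sum to 0.  For the product of covariances of orders m and n one takes order
   m + n, lets the first indicator act on the first m points and the second on the last n points,
   and uses the product group acting blockwise: the signed sums multiply, and the two blocks are
   independent. *)
theory Submission
  imports Defs
begin

section \<open>Sign sums, measurability and bounds\<close>

lemma balanced_subgroup_permutes:
  assumes "balanced_subgroup m H" "\<sigma> \<in> H"
  shows "\<sigma> permutes {1..m}"
  using assms subgroup.subset[of H "sym_group m"]
  by (auto simp: balanced_subgroup_def sym_group_carrier)

lemma sum_sign:
  assumes "finite H"
  shows "(\<Sum>\<sigma>\<in>H. sign \<sigma>) = int (card {\<sigma>\<in>H. evenperm \<sigma>}) - int (card {\<sigma>\<in>H. \<not> evenperm \<sigma>})"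
proof -
  have "(\<Sum>\<sigma>\<in>H. sign \<sigma>) = (\<Sum>\<sigma>\<in>H. of_bool (evenperm \<sigma>) - of_bool (\<not> evenperm \<sigma>))"
    by (intro sum.cong) (auto simp: sign_def)
  also have "\<dots> = int (card {\<sigma>\<in>H. evenperm \<sigma>}) - int (card {\<sigma>\<in>H. \<not> evenperm \<sigma>})"
    using assms by (simp add: sum_subtractf of_bool_def sum.If_cases Int_def)
  finally show ?thesis .
qed

text \<open>Since \<open>H\<close> is finite, its sign sum is the number of even minus the number of
  odd elements. In this form the balance condition factors out of expectations and multiplies over
  product groups.\<close>

lemma balanced_subgroup_iff_sum_sign:
  "balanced_subgroup m H \<longleftrightarrow> subgroup H (sym_group m) \<and> (\<Sum>\<sigma>\<in>H. sign \<sigma>) = 0"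
proof (cases "subgroup H (sym_group m)")
  case True
  then have "finite H"
    using subgroup.subset[OF True] finite_permutations[of "{1..m}"]
    by (auto simp: sym_group_def intro: finite_subset)
  with True show ?thesis by (simp add: balanced_subgroup_def sum_sign)
qed (simp add: balanced_subgroup_def)

lemma permutes_inv_atLeastAtMost:
  assumes "\<sigma> permutes {1..m}" "j \<in> {1..m}"
  shows "inv_into UNIV \<sigma> j \<in> {1..m}"
  using assms permutes_in_image[OF permutes_inv[OF assms(1)]] by simp

lemma permute_tuple_in_tuples: "permute_tuple m \<sigma> w \<in> tuples m"
  by (simp add: permute_tuple_def tuples_def)

lemma rank_indicatorD:
  assumes "rank_indicator m I" "w \<in> tuples m"
  shows "I w = I (joint_rank m w)"
  using assms by (simp add: rank_indicator_def)

text \<open>\<open>I\<close> factors through \<open>joint_rank m\<close>, which is measurable into a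
  discrete space, and every function on a discrete space is measurable.\<close>

lemma rank_indicator_measurable:
  fixes F :: "nat \<Rightarrow> 'b \<Rightarrow> real ^ 'd::finite"
  assumes I: "rank_indicator m I"
    and F: "\<And>j. j \<in> {1..m} \<Longrightarrow> F j \<in> borel_measurable M"
  shows "(\<lambda>x. I (\<lambda>j\<in>{1..m}. F j x)) \<in> borel_measurable M"
proof -
  have "(\<lambda>x. I (joint_rank m (\<lambda>j\<in>{1..m}. F j x))) \<in> borel_measurable M"
    by (rule measurable_compose[OF joint_rank_measurable]) (use F in auto)
  moreover have "I (joint_rank m (\<lambda>j\<in>{1..m}. F j x)) = I (\<lambda>j\<in>{1..m}. F j x)" for x
    using I by (auto simp: rank_indicator_def tuples_def)
  ultimately show ?thesis by simp
qed

lemma rank_indicator_abs_le: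
  assumes "rank_indicator m I" "w \<in> tuples m"
  shows "\<bar>I w\<bar> \<le> 1"
  using assms by (auto simp: rank_indicator_def)

lemma abs_signed_sum_le:
  assumes "rank_indicator m I"
  shows "\<bar>signed_sum m H I w\<bar> \<le> card H"
proof -
  have "\<bar>signed_sum m H I w\<bar> \<le> (\<Sum>\<sigma>\<in>H. \<bar>of_int (sign \<sigma>) * I (permute_tuple m \<sigma> w)\<bar>)"
    unfolding signed_sum_def by (rule sum_abs)
  also have "\<dots> \<le> (\<Sum>\<sigma>\<in>H. 1)"
    by (intro sum_mono)
       (use rank_indicator_abs_le[OF assms permute_tuple_in_tuples] in \<open>auto simp: abs_mult sign_def\<close>)
  finally show ?thesis by simp
qed

section \<open>Invariance under monotone transformations\<close>

text \<open>Ranks record only the comparisons within each coordinate, and a strictly increasing map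
  preserves and reflects these.\<close>

lemma joint_rank_strict_mono:
  fixes f :: "'d::finite \<Rightarrow> real \<Rightarrow> real"
  assumes "\<And>i. strict_mono (f i)"
  shows "joint_rank m (\<lambda>j\<in>{1..m}. \<chi> i. f i (w j $ i)) = joint_rank m w"
  unfolding joint_rank_def
  by (rule restrict_ext) (auto simp: vec_eq_iff strict_mono_less[OF assms] intro!: sum.cong)

lemma rank_indicator_strict_mono:
  fixes f :: "'d::finite \<Rightarrow> real \<Rightarrow> real"
  assumes "rank_indicator m I" "w \<in> tuples m" and f: "\<And>i. strict_mono (f i)"
  shows "I (\<lambda>j\<in>{1..m}. \<chi> i. f i (w j $ i)) = I w"
proof -
  have "(\<lambda>j\<in>{1..m}. \<chi> i. f i (w j $ i)) \<in> tuples m"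
    by (simp add: tuples_def)
  from rank_indicatorD[OF assms(1) this] show ?thesis
    by (simp only: joint_rank_strict_mono[OF f] rank_indicatorD[OF assms(1,2)])
qed

text \<open>A coordinatewise map treats each point separately and so commutes with permuting the
  points; invariance then holds summand by summand.\<close>

lemma signed_sum_strict_mono:
  fixes f :: "'d::finite \<Rightarrow> real \<Rightarrow> real"
  assumes I: "rank_indicator m I" and H: "balanced_subgroup m H" and f: "\<And>i. strict_mono (f i)"
  shows "signed_sum m H I (\<lambda>j\<in>{1..m}. \<chi> i. f i (w j $ i)) = signed_sum m H I w"
  unfolding signed_sum_def
proof (intro sum.cong refl arg_cong2[where f = "(*)"])
  fix \<sigma> assume "\<sigma> \<in> H"
  then have "permute_tuple m \<sigma> (\<lambda>j\<in>{1..m}. \<chi> i. f i (w j $ i)) =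
      (\<lambda>j\<in>{1..m}. \<chi> i. f i (permute_tuple m \<sigma> w j $ i))"
    using permutes_inv_atLeastAtMost[OF balanced_subgroup_permutes[OF H]]
    unfolding permute_tuple_def by (intro restrict_ext) simp
  then show "I (permute_tuple m \<sigma> (\<lambda>j\<in>{1..m}. \<chi> i. f i (w j $ i))) = I (permute_tuple m \<sigma> w)"
    using rank_indicator_strict_mono[OF I permute_tuple_in_tuples f] by simp
qed

text \<open>A strictly increasing function may be discontinuous, but monotonicity makes it Borel;
  the vector map is then checked one coordinate at a time.\<close>

lemma strict_mono_vec_measurable:
  fixes f :: "'d::finite \<Rightarrow> real \<Rightarrow> real"
  assumes "\<And>i. strict_mono (f i)"
  shows "(\<lambda>x :: real ^ 'd. \<chi> i. f i (x $ i)) \<in> borel_measurable borel"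
proof -
  have "(\<lambda>x :: real ^ 'd. x $ i) \<in> borel_measurable borel" for i
    by (intro borel_measurable_continuous_onI continuous_on_component continuous_on_id)
  moreover have "f i \<in> borel_measurable borel" for i
    by (intro borel_measurable_mono strict_mono_mono assms)
  ultimately have "(\<lambda>x :: real ^ 'd. f i (x $ i)) \<in> borel_measurable borel" for i
    by (rule measurable_compose)
  then show ?thesis
    by (intro borel_measurable_euclidean_space[THEN iffD2])
       (auto simp: Basis_vec_def inner_axis)
qed

definition src_integrand ::
    "nat \<Rightarrow> ((nat \<Rightarrow> real ^ 'r) \<Rightarrow> real) \<Rightarrow> ((nat \<Rightarrow> real ^ 's) \<Rightarrow> real) \<Rightarrow> (nat \<Rightarrow> nat) set
       \<Rightarrow> (nat \<Rightarrow> (real ^ 'r) \<times> (real ^ 's)) \<Rightarrow> real" where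
  "src_integrand m I\<^sub>X I\<^sub>Y H z =
     signed_sum m H I\<^sub>X (\<lambda>j\<in>{1..m}. fst (z j)) * signed_sum m H I\<^sub>Y (\<lambda>j\<in>{1..m}. snd (z j))"

lemma src_eq_integral:
  "src m I\<^sub>X I\<^sub>Y H L = (LINT z | Pi\<^sub>M {1..m} (\<lambda>_. L). src_integrand m I\<^sub>X I\<^sub>Y H z)"
  by (simp add: src_def src_integrand_def)

lemma src_integrand_measurable:
  fixes I\<^sub>X :: "(nat \<Rightarrow> real ^ 'r::finite) \<Rightarrow> real" and I\<^sub>Y :: "(nat \<Rightarrow> real ^ 's::finite) \<Rightarrow> real"
  assumes "rank_indicator m I\<^sub>X" "rank_indicator m I\<^sub>Y" "balanced_subgroup m H"
    and L: "sets L = sets borel"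
  shows "src_integrand m I\<^sub>X I\<^sub>Y H \<in> borel_measurable (Pi\<^sub>M {1..m} (\<lambda>_. L))"
proof -
  have "fst \<in> borel_measurable L" "snd \<in> borel_measurable L"
    unfolding measurable_cong_sets[OF L refl]
    by (intro borel_measurable_continuous_onI continuous_intros)+
  then show ?thesis
    unfolding src_integrand_def
    by (intro borel_measurable_times signed_sum_measurable assms)
       (auto intro!: measurable_compose[OF measurable_component_singleton])
qed

lemma abs_src_integrand_le:
  assumes "rank_indicator m I\<^sub>X" "rank_indicator m I\<^sub>Y"
  shows "\<bar>src_integrand m I\<^sub>X I\<^sub>Y H z\<bar> \<le> real (card H) * real (card H)"
  unfolding src_integrand_def abs_mult
  by (intro mult_mono abs_signed_sum_le assms) auto

text \<open>Product measures commute with pointwise push-forward, so a change of variables moves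
  \<open>T\<close> into the integrand, which is invariant under it. Measurability of
  \<open>T\<close> is exported as well, because it serves to identify the law of the transformed
  pair.\<close>

lemma src_strict_mono:
  fixes L :: "((real ^ 'r::finite) \<times> (real ^ 's::finite)) measure"
    and f :: "'r \<Rightarrow> real \<Rightarrow> real" and g :: "'s \<Rightarrow> real \<Rightarrow> real"
  assumes IX: "rank_indicator m I\<^sub>X" and IY: "rank_indicator m I\<^sub>Y" and H: "balanced_subgroup m H"
    and L: "prob_space L" "sets L = sets borel"
    and f: "\<And>i. strict_mono (f i)" and g: "\<And>i. strict_mono (g i)"
  defines "T \<equiv> (\<lambda>z. (\<chi> i. f i (fst z $ i), \<chi> i. g i (snd z $ i)))"
  shows "T \<in> measurable L borel"
    and "src m I\<^sub>X I\<^sub>Y H (distr L borel T) = src m I\<^sub>X I\<^sub>Y H L"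
proof -
  have "T \<in> borel_measurable borel"
    unfolding T_def borel_prod[symmetric]
    by (intro measurable_Pair measurable_compose[OF measurable_fst] measurable_compose[OF measurable_snd]
        strict_mono_vec_measurable f g)
  then show T: "T \<in> measurable L borel"
    by (simp add: measurable_cong_sets[OF L(2) refl])
  define D where "D = distr L borel T"
  have D: "prob_space D" "sets D = sets borel"
    unfolding D_def by (auto intro: prob_space.prob_space_distr L T)
  \<comment> \<open>Taking \<open>D\<close> itself as the target space leaves the push-forward
    unchanged, since \<open>D\<close> carries the Borel sets, and brings it into the form in which
    product and push-forward can be exchanged.\<close>
  have "Pi\<^sub>M {1..m} (\<lambda>_. D) = Pi\<^sub>M {1..m} (\<lambda>_. distr L D T)"
    by (auto simp: D_def intro!: PiM_cong distr_cong)
  also have "\<dots> = distr (Pi\<^sub>M {1..m} (\<lambda>_. L)) (Pi\<^sub>M {1..m} (\<lambda>_. D)) (compose {1..m} T)"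
    by (rule distr_PiM_finite_prob_space'[symmetric]) (use L D T in \<open>auto simp: D_def\<close>)
  finally have *: "Pi\<^sub>M {1..m} (\<lambda>_. D) =
      distr (Pi\<^sub>M {1..m} (\<lambda>_. L)) (Pi\<^sub>M {1..m} (\<lambda>_. D)) (compose {1..m} T)" .
  have "src m I\<^sub>X I\<^sub>Y H D = (LINT z | Pi\<^sub>M {1..m} (\<lambda>_. L). src_integrand m I\<^sub>X I\<^sub>Y H (compose {1..m} T z))"
    unfolding src_eq_integral
  proof (subst *, rule integral_distr)
    show "compose {1..m} T \<in> measurable (Pi\<^sub>M {1..m} (\<lambda>_. L)) (Pi\<^sub>M {1..m} (\<lambda>_. D))"
      unfolding compose_def
      by (intro measurable_restrict measurable_compose[OF measurable_component_singleton])
         (use T in \<open>auto simp: D_def\<close>)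
  qed (rule src_integrand_measurable[OF IX IY H D(2)])
  also have "\<dots> = (LINT z | Pi\<^sub>M {1..m} (\<lambda>_. L). src_integrand m I\<^sub>X I\<^sub>Y H z)"
  proof (rule Bochner_Integration.integral_cong[OF refl])
    fix z
    have "(\<lambda>j\<in>{1..m}. fst (compose {1..m} T z j)) =
        (\<lambda>j\<in>{1..m}. \<chi> i. f i ((\<lambda>j\<in>{1..m}. fst (z j)) j $ i))"
      "(\<lambda>j\<in>{1..m}. snd (compose {1..m} T z j)) =
        (\<lambda>j\<in>{1..m}. \<chi> i. g i ((\<lambda>j\<in>{1..m}. snd (z j)) j $ i))"
      by (auto intro!: restrict_ext simp: compose_def T_def)
    then show "src_integrand m I\<^sub>X I\<^sub>Y H (compose {1..m} T z) = src_integrand m I\<^sub>X I\<^sub>Y H z"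
      unfolding src_integrand_def
      by (simp only: signed_sum_strict_mono[OF IX H f] signed_sum_strict_mono[OF IY H g])
  qed
  finally show "src m I\<^sub>X I\<^sub>Y H (distr L borel T) = src m I\<^sub>X I\<^sub>Y H L"
    by (simp add: D_def src_eq_integral)
qed

section \<open>Independence\<close>

text \<open>An i.i.d. tuple is exchangeable, so all summands have the same expectation up to sign.
  It factors out and leaves the sign sum of \<open>H\<close>, which is 0.\<close>

lemma integral_signed_sum_PiM:
  fixes P :: "(real ^ 'd::finite) measure"
  assumes I: "rank_indicator m I" and H: "balanced_subgroup m H"
    and P: "prob_space P" "sets P = sets borel"
  shows "(LINT w | Pi\<^sub>M {1..m} (\<lambda>_. P). signed_sum m H I w) = 0"
proof -
  let ?P = "Pi\<^sub>M {1..m} (\<lambda>_. P)"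
  interpret prob_space ?P by (intro prob_space_PiM P)
  have comp: "(\<lambda>w. w j) \<in> borel_measurable ?P" if "j \<in> {1..m}" for j
    using that measurable_component_singleton[of j "{1..m}" "\<lambda>_. P"]
    by (simp add: measurable_cong_sets[OF refl P(2)])
  have Im: "I \<in> borel_measurable ?P"
  proof -
    \<comment> \<open>Points of the product space are extensional, so the restriction to
      \<open>{1..m}\<close> changes nothing on it.\<close>
    have "(\<lambda>w. I (\<lambda>j\<in>{1..m}. w j)) \<in> borel_measurable ?P"
      by (rule rank_indicator_measurable[OF I comp])
    then show ?thesis
      by (rule measurable_cong[THEN iffD1, rotated]) (auto simp: space_PiM PiE_restrict)
  qed
  have *: "integrable ?P (\<lambda>w. I (permute_tuple m \<sigma> w)) \<and>
      (LINT w | ?P. I (permute_tuple m \<sigma> w)) = (LINT w | ?P. I w)" if "\<sigma> \<in> H" for \<sigma>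
  proof -
    have perm: "\<sigma> permutes {1..m}" by (rule balanced_subgroup_permutes[OF H that])
    \<comment> \<open>Exchangeability: reindexing equal factors along an injection of
      \<open>{1..m}\<close> into itself, here the inverse of \<sigma>, preserves the product
      measure.\<close>
    have D: "distr ?P ?P (permute_tuple m \<sigma>) = ?P"
      unfolding permute_tuple_def
      by (rule distr_PiM_reindex)
         (use P permutes_inv_atLeastAtMost[OF perm] permutes_inj[OF permutes_inv[OF perm]]
          in \<open>auto intro: inj_on_subset\<close>)
    have m: "permute_tuple m \<sigma> \<in> measurable ?P ?P"
      unfolding permute_tuple_def
      by (intro measurable_restrict measurable_component_singleton permutes_inv_atLeastAtMost[OF perm])
    have "integrable ?P (\<lambda>w. I (permute_tuple m \<sigma> w))"
      by (rule integrable_const_bound[where B = 1, OF _ measurable_compose[OF m Im]])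
         (use rank_indicator_abs_le[OF I permute_tuple_in_tuples] in auto)
    with integral_distr[OF m Im] show ?thesis by (simp only: D)
  qed
  have "(LINT w | ?P. signed_sum m H I w) =
      (\<Sum>\<sigma>\<in>H. of_int (sign \<sigma>) * (LINT w | ?P. I (permute_tuple m \<sigma> w)))"
    unfolding signed_sum_def using * by (subst Bochner_Integration.integral_sum) auto
  also have "\<dots> = of_int (\<Sum>\<sigma>\<in>H. sign \<sigma>) * (LINT w | ?P. I w)"
    using * by (simp add: sum_distrib_right)
  also have "\<dots> = 0"
    using H by (simp add: balanced_subgroup_iff_sum_sign del: of_int_sum)
  finally show ?thesis .
qed

text \<open>Both measures are compared on boxes \<open>Pi\<^sub>E I A\<close>. Integrating the mass
  of the slices gives an integral of a product of functions of the single coordinates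
  \<open>x i\<close>, which factors over \<open>I\<close>; each factor is the mass of
  \<open>A i\<close>.\<close>

lemma PiM_pair_measure:
  assumes I: "finite I" and P: "prob_space P" and Q: "prob_space Q"
  shows "Pi\<^sub>M I (\<lambda>_. P \<Otimes>\<^sub>M Q) =
     distr (Pi\<^sub>M I (\<lambda>_. P) \<Otimes>\<^sub>M Pi\<^sub>M I (\<lambda>_. Q)) (Pi\<^sub>M I (\<lambda>_. P \<Otimes>\<^sub>M Q)) (\<lambda>(x, y). \<lambda>i\<in>I. (x i, y i))"
    (is "_ = distr ?PQ ?R ?t")
proof -
  interpret P: prob_space P by (rule P)
  interpret Q: prob_space Q by (rule Q)
  interpret PQ: pair_prob_space P Q ..
  interpret FP: finite_product_prob_space "\<lambda>_. P" I by unfold_locales (rule I)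
  interpret FQ: finite_product_prob_space "\<lambda>_. Q" I by unfold_locales (rule I)
  interpret FR: finite_product_prob_space "\<lambda>_. P \<Otimes>\<^sub>M Q" I by unfold_locales (rule I)
  have t: "?t \<in> measurable ?PQ ?R"
    unfolding case_prod_beta
    by (intro measurable_restrict measurable_Pair measurable_compose[OF measurable_fst]
        measurable_compose[OF measurable_snd] measurable_component_singleton)
  show ?thesis
  proof (rule FR.PiM_eqI[symmetric])
    fix A assume A: "\<And>i. i \<in> I \<Longrightarrow> A i \<in> sets (P \<Otimes>\<^sub>M Q)"
    have PA: "Pi\<^sub>E I A \<in> sets ?R" by (rule sets_PiM_I_finite[OF I A])
    \<comment> \<open>\<open>A i\<close> is an arbitrary measurable set of pairs, so it is sliced at
      fixed \<open>x\<close>: the slice of the preimage of a box is again a box in the coordinates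
      of \<open>y\<close>.\<close>
    have slice: "Pair x -` (?t -` Pi\<^sub>E I A \<inter> space ?PQ) = Pi\<^sub>E I (\<lambda>i. Pair (x i) -` A i)"
      if x: "x \<in> space (Pi\<^sub>M I (\<lambda>_. P))" for x
    proof (intro equalityI subsetI)
      fix y assume y: "y \<in> Pair x -` (?t -` Pi\<^sub>E I A \<inter> space ?PQ)"
      then have "y \<in> space (Pi\<^sub>M I (\<lambda>_. Q))"
        using x by (auto simp: space_pair_measure)
      with y show "y \<in> Pi\<^sub>E I (\<lambda>i. Pair (x i) -` A i)"
        by (auto simp: PiE_iff space_PiM)
    next
      fix y assume y: "y \<in> Pi\<^sub>E I (\<lambda>i. Pair (x i) -` A i)"
      have "y i \<in> space Q" if "i \<in> I" for i
        using y sets.sets_into_space[OF A[OF that]] that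
        by (auto simp: PiE_iff space_pair_measure)
      with x y show "y \<in> Pair x -` (?t -` Pi\<^sub>E I A \<inter> space ?PQ)"
        by (auto simp: PiE_iff space_pair_measure space_PiM)
    qed
    have "emeasure (distr ?PQ ?R ?t) (Pi\<^sub>E I A) = emeasure ?PQ (?t -` Pi\<^sub>E I A \<inter> space ?PQ)"
      by (rule emeasure_distr[OF t PA])
    also have "\<dots> = (\<integral>\<^sup>+x. emeasure (Pi\<^sub>M I (\<lambda>_. Q)) (Pair x -` (?t -` Pi\<^sub>E I A \<inter> space ?PQ)) \<partial>Pi\<^sub>M I (\<lambda>_. P))"
      by (rule FQ.emeasure_pair_measure_alt) (rule measurable_sets[OF t PA])
    also have "\<dots> = (\<integral>\<^sup>+x. (\<Prod>i\<in>I. emeasure Q (Pair (x i) -` A i)) \<partial>Pi\<^sub>M I (\<lambda>_. P))"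
      by (intro nn_integral_cong, subst slice) (auto intro!: FQ.emeasure_PiM I sets_Pair1 A)
    also have "\<dots> = (\<Prod>i\<in>I. \<integral>\<^sup>+x. emeasure Q (Pair x -` A i) \<partial>P)"
      by (rule FP.product_nn_integral_prod[OF I]) (intro Q.measurable_emeasure_Pair A)
    also have "\<dots> = (\<Prod>i\<in>I. emeasure (P \<Otimes>\<^sub>M Q) (A i))"
      by (intro prod.cong refl Q.emeasure_pair_measure_alt[symmetric] A)
    finally show "emeasure (distr ?PQ ?R ?t) (Pi\<^sub>E I A) = (\<Prod>i\<in>I. emeasure (P \<Otimes>\<^sub>M Q) (A i))" .
  qed (auto intro: I)
qed

text \<open>After regrouping the pairs into two independent tuples, the integrand is a function of
  \<open>x\<close> times a function of \<open>y\<close>. By Fubini one may integrate over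
  \<open>x\<close> first, which already gives 0.\<close>

lemma src_pair_measure:
  fixes P :: "(real ^ 'r::finite) measure" and Q :: "(real ^ 's::finite) measure"
  assumes IX: "rank_indicator m I\<^sub>X" and IY: "rank_indicator m I\<^sub>Y" and H: "balanced_subgroup m H"
    and P: "prob_space P" "sets P = sets borel" and Q: "prob_space Q" "sets Q = sets borel"
  shows "src m I\<^sub>X I\<^sub>Y H (P \<Otimes>\<^sub>M Q) = 0"
proof -
  let ?P = "Pi\<^sub>M {1..m} (\<lambda>_. P)" and ?Q = "Pi\<^sub>M {1..m} (\<lambda>_. Q)"
  let ?t = "\<lambda>(x, y). \<lambda>i\<in>{1..m}. (x i, y i)" and ?g = "src_integrand m I\<^sub>X I\<^sub>Y H"
  interpret P: prob_space ?P by (intro prob_space_PiM P)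
  interpret Q: prob_space ?Q by (intro prob_space_PiM Q)
  interpret PQ: pair_prob_space ?P ?Q ..
  have PQb: "sets (P \<Otimes>\<^sub>M Q) = sets borel"
    by (rule sets_pair_measure_cong[OF P(2) Q(2), unfolded borel_prod])
  note g = src_integrand_measurable[OF IX IY H PQb]
  have t: "?t \<in> measurable (?P \<Otimes>\<^sub>M ?Q) (Pi\<^sub>M {1..m} (\<lambda>_. P \<Otimes>\<^sub>M Q))"
    unfolding case_prod_beta
    by (intro measurable_restrict measurable_Pair measurable_compose[OF measurable_fst]
        measurable_compose[OF measurable_snd] measurable_component_singleton)
  have int: "integrable (?P \<Otimes>\<^sub>M ?Q) (\<lambda>z. ?g (?t z))"
    by (rule PQ.integrable_const_bound[where B = "real (card H) * real (card H)", OF _ measurable_compose[OF t g]])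
       (use abs_src_integrand_le[OF IX IY] in auto)
  \<comment> \<open>Fubini is applied to a curried integrand; this identifies its uncurried form
    with the composition with \<open>?t\<close>.\<close>
  have uncurry: "case_prod (\<lambda>x y. ?g (?t (x, y))) = (\<lambda>z. ?g (?t z))"
    by (rule ext) (simp add: case_prod_unfold)
  have "src m I\<^sub>X I\<^sub>Y H (P \<Otimes>\<^sub>M Q) = (LINT z | (?P \<Otimes>\<^sub>M ?Q). ?g (?t z))"
    unfolding src_eq_integral
    by (subst PiM_pair_measure[OF finite_atLeastAtMost P(1) Q(1)]) (rule integral_distr[OF t g])
  also have "\<dots> = (LINT y | ?Q. LINT x | ?P. ?g (?t (x, y)))"
    by (rule PQ.integral_snd[of "\<lambda>x y. ?g (?t (x, y))", unfolded uncurry, OF int, symmetric])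
  also have "\<dots> = (LINT y | ?Q. LINT x | ?P. signed_sum m H I\<^sub>X x * signed_sum m H I\<^sub>Y y)"
  proof (intro Bochner_Integration.integral_cong refl)
    fix x y assume "y \<in> space ?Q" "x \<in> space ?P"
    then have "(\<lambda>j\<in>{1..m}. fst (?t (x, y) j)) = x" "(\<lambda>j\<in>{1..m}. snd (?t (x, y) j)) = y"
      by (auto simp: space_PiM PiE_iff extensional_def fun_eq_iff)
    then show "?g (?t (x, y)) = signed_sum m H I\<^sub>X x * signed_sum m H I\<^sub>Y y"
      unfolding src_integrand_def by (simp only:)
  qed
  also have "\<dots> = 0"
    using integral_signed_sum_PiM[OF IX H P] by simp
  finally show ?thesis .
qed

text \<open>A probability measure on the product space is determined by its values on rectangles,
  and there independence of the generated sigma-algebras is the product formula.\<close>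

lemma joint_law_indep:
  fixes X :: "'a \<Rightarrow> real ^ 'r::finite" and Y :: "'a \<Rightarrow> real ^ 's::finite"
  assumes M: "prob_space M" and X: "X \<in> borel_measurable M" and Y: "Y \<in> borel_measurable M"
    and indep: "indep_vectors M X Y"
  shows "joint_law M X Y = distr M borel X \<Otimes>\<^sub>M distr M borel Y"
proof -
  interpret M: prob_space M by (rule M)
  interpret PX: prob_space "distr M borel X" by (rule M.prob_space_distr[OF X])
  interpret PY: prob_space "distr M borel Y" by (rule M.prob_space_distr[OF Y])
  have XY: "(\<lambda>\<omega>. (X \<omega>, Y \<omega>)) \<in> borel_measurable M"
    unfolding borel_prod[symmetric] by (rule measurable_Pair[OF X Y])
  show ?thesis
  proof (rule pair_measure_eqI[symmetric])
    show "sets (distr M borel X \<Otimes>\<^sub>M distr M borel Y) = sets (joint_law M X Y)"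
      unfolding joint_law_def sets_distr borel_prod[symmetric]
      by (intro sets_pair_measure_cong sets_distr)
    fix A B assume "A \<in> sets (distr M borel X)" "B \<in> sets (distr M borel Y)"
    then have A: "A \<in> sets borel" and B: "B \<in> sets borel" by auto
    have "A \<times> B \<in> sets borel"
      unfolding borel_prod[symmetric] using A B by (rule pair_measureI)
    then have "emeasure (joint_law M X Y) (A \<times> B) = emeasure M ((X -` A \<inter> space M) \<inter> (Y -` B \<inter> space M))"
      unfolding joint_law_def by (subst emeasure_distr[OF XY]) (auto intro!: arg_cong[where f = "emeasure M"])
    also have "\<dots> = M.prob (X -` A \<inter> space M) * M.prob (Y -` B \<inter> space M)"
      unfolding M.emeasure_eq_measure
      by (subst M.indep_setD[OF indep[unfolded indep_vectors_def]]) (use A B in auto)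
    finally show "emeasure (distr M borel X) A * emeasure (distr M borel Y) B =
        emeasure (joint_law M X Y) (A \<times> B)"
      using A B X Y by (simp add: emeasure_distr M.emeasure_eq_measure ennreal_mult)
  qed unfold_locales
qed

section \<open>Products\<close>

text \<open>The block at positions \<open>k + 1\<close> to \<open>k + n\<close>, reindexed from 1,
  so that \<open>subtuple 0 m\<close> and \<open>subtuple m n\<close> split a tuple of length
  \<open>m + n\<close>.\<close>

definition subtuple :: "nat \<Rightarrow> nat \<Rightarrow> (nat \<Rightarrow> 'b) \<Rightarrow> (nat \<Rightarrow> 'b)" where
  "subtuple k n w = (\<lambda>j\<in>{1..n}. w (k + j))"

text \<open>Used with \<open>p\<close> as \<open>fst\<close> or \<open>snd\<close>, to pass from a
  block of pairs to the blocks of their components. All positions read lie in \<open>{1..m}\<close>,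
  where the restriction is transparent.\<close>

lemma map_subtuple:
  assumes "k + l \<le> m"
  shows "(\<lambda>j\<in>{1..l}. p (subtuple k l z j)) = subtuple k l (\<lambda>j\<in>{1..m}. p (z j))"
  using assms by (auto simp: subtuple_def)

section \<open>Ranks within a block\<close>

lemma joint_rank_mono:
  assumes "a \<in> {1..m}" "b \<in> {1..m}" "w a $ i \<le> w b $ i"
  shows "joint_rank m w a $ i \<le> joint_rank m w b $ i"
proof -
  have "(\<Sum>k=1..m. of_bool (w k $ i < w a $ i)) \<le> (\<Sum>k=1..m. of_bool (w k $ i < w b $ i) :: real)"
    by (rule sum_mono) (use assms in auto)
  then show ?thesis using assms(1,2) by (simp add: joint_rank_def)
qed

lemma joint_rank_less:
  assumes "a \<in> {1..m}" "b \<in> {1..m}" "w a $ i < w b $ i"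
  shows "joint_rank m w a $ i < joint_rank m w b $ i"
proof -
  \<comment> \<open>Strictness comes from \<open>k = a\<close>, which is counted on the right but
    not on the left.\<close>
  have "(\<Sum>k=1..m. of_bool (w k $ i < w a $ i)) < (\<Sum>k=1..m. of_bool (w k $ i < w b $ i) :: real)"
    by (rule sum_strict_mono_ex1) (use assms in \<open>auto intro!: bexI[of _ a]\<close>)
  then show ?thesis using assms(1,2) by (simp add: joint_rank_def)
qed

lemma joint_rank_less_iff:
  assumes "a \<in> {1..m}" "b \<in> {1..m}"
  shows "joint_rank m w a $ i < joint_rank m w b $ i \<longleftrightarrow> w a $ i < w b $ i"
  using joint_rank_mono[OF assms(2,1), of w i] joint_rank_less[OF assms, of w i] by fastforce

text \<open>Ranks in the whole tuple differ in general from ranks in the block, but they are ordered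
  like the values, and ranking the block sees only this order.\<close>

lemma joint_rank_subtuple:
  assumes "k + n \<le> m"
  shows "joint_rank n (subtuple k n (joint_rank m w)) = joint_rank n (subtuple k n w)"
proof -
  have "joint_rank m w (k + l) $ i < joint_rank m w (k + j) $ i \<longleftrightarrow> w (k + l) $ i < w (k + j) $ i"
    if "l \<in> {1..n}" "j \<in> {1..n}" for l j i
    by (rule joint_rank_less_iff) (use that assms in auto)
  then show ?thesis
    unfolding joint_rank_def[of n]
    by (intro restrict_ext) (auto simp: vec_eq_iff subtuple_def intro!: sum.cong)
qed

text \<open>Passing to the joint ranks of the whole tuple keeps the ranks within either block, hence
  both factors; products of values in \<open>{0, 1}\<close> stay in \<open>{0, 1}\<close>.\<close>

lemma rank_indicator_prod:
  assumes I: "rank_indicator m I" and J: "rank_indicator n J"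
  shows "rank_indicator (m + n) (\<lambda>w. I (subtuple 0 m w) * J (subtuple m n w))"
proof -
  have sub: "subtuple k l w \<in> tuples l" for k l and w :: "nat \<Rightarrow> real ^ 'a"
    by (simp add: subtuple_def tuples_def)
  have "I (subtuple 0 m (joint_rank (m + n) w)) = I (subtuple 0 m w)"
    "J (subtuple m n (joint_rank (m + n) w)) = J (subtuple m n w)" for w
    unfolding rank_indicatorD[OF I sub] rank_indicatorD[OF J sub]
    by (simp_all add: joint_rank_subtuple)
  moreover have "I (subtuple 0 m w) \<in> {0, 1}" "J (subtuple m n w) \<in> {0, 1}" for w
    using I J sub by (auto simp: rank_indicator_def)
  ultimately show ?thesis
    by (fastforce simp: rank_indicator_def)
qed

section \<open>Block permutations\<close>

text \<open>The direct sum of two permutations. The argument 0 falls into the first branch, where a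
  permutation of \<open>{1..m}\<close> fixes it.\<close>

definition block_perm :: "nat \<Rightarrow> (nat \<Rightarrow> nat) \<Rightarrow> (nat \<Rightarrow> nat) \<Rightarrow> (nat \<Rightarrow> nat)" where
  "block_perm m \<sigma> \<tau> j = (if j \<le> m then \<sigma> j else m + \<tau> (j - m))"

lemma permutes_le_iff:
  fixes \<sigma> :: "nat \<Rightarrow> nat"
  assumes "\<sigma> permutes {1..m}"
  shows "\<sigma> j \<le> m \<longleftrightarrow> j \<le> m"
  using permutes_in_image[OF assms, of j] permutes_not_in[OF assms, of j]
  by (cases "j \<in> {1..m}") auto

lemma permutes_pos_iff:
  fixes \<sigma> :: "nat \<Rightarrow> nat"
  assumes "\<sigma> permutes {1..m}"
  shows "0 < \<sigma> j \<longleftrightarrow> 0 < j"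
  using permutes_in_image[OF assms, of j] permutes_not_in[OF assms, of j]
  by (cases "j \<in> {1..m}") auto

text \<open>Each argument stays in its branch: \<sigma>' maps the numbers up to \<open>m\<close> to
  themselves, and \<tau>' keeps positive numbers positive, so its shifted values stay above
  \<open>m\<close>.\<close>

lemma block_perm_comp:
  assumes "\<sigma>' permutes {1..m}" "\<tau>' permutes {1..n}"
  shows "block_perm m \<sigma> \<tau> \<circ> block_perm m \<sigma>' \<tau>' = block_perm m (\<sigma> \<circ> \<sigma>') (\<tau> \<circ> \<tau>')"
proof
  fix j
  show "(block_perm m \<sigma> \<tau> \<circ> block_perm m \<sigma>' \<tau>') j = block_perm m (\<sigma> \<circ> \<sigma>') (\<tau> \<circ> \<tau>') j"
    using permutes_le_iff[OF assms(1), of j] permutes_pos_iff[OF assms(2), of "j - m"]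
    by (auto simp: block_perm_def)
qed

lemma block_perm_id: "block_perm m id id = id"
  by (auto simp: block_perm_def fun_eq_iff)

lemma inv_block_perm:
  assumes "\<sigma> permutes {1..m}" "\<tau> permutes {1..n}"
  shows "inv_into UNIV (block_perm m \<sigma> \<tau>) = block_perm m (inv_into UNIV \<sigma>) (inv_into UNIV \<tau>)"
  by (rule inv_unique_comp)
     (simp_all only: block_perm_comp[OF assms] block_perm_comp[OF assms[THEN permutes_inv]]
        assms[THEN permutes_inv_o(1)] assms[THEN permutes_inv_o(2)] block_perm_id)

lemma block_perm_inject:
  assumes "\<sigma> permutes {1..m}" "\<sigma>' permutes {1..m}" "\<tau> permutes {1..n}" "\<tau>' permutes {1..n}"
    and eq: "block_perm m \<sigma> \<tau> = block_perm m \<sigma>' \<tau>'"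
  shows "\<sigma> = \<sigma>' \<and> \<tau> = \<tau>'"
proof (intro conjI ext)
  fix j
  show "\<sigma> j = \<sigma>' j"
    using fun_cong[OF eq, of j] permutes_not_in[OF assms(1), of j] permutes_not_in[OF assms(2), of j]
    by (cases "j \<le> m") (auto simp: block_perm_def)
  \<comment> \<open>Evaluation at \<open>m + j\<close> reads off the second component, except at
    \<open>j = 0\<close>, where \<open>m + j\<close> still lies in the first branch; both
    permutations fix 0.\<close>
  show "\<tau> j = \<tau>' j"
    using fun_cong[OF eq, of "m + j"] permutes_not_in[OF assms(3), of j] permutes_not_in[OF assms(4), of j]
    by (cases "j = 0") (auto simp: block_perm_def)
qed

text \<open>Splits the direct sum into permutations with disjoint supports, the second being \<tau>
  transported along the shift by \<open>m\<close>. Its support and its sign are then obtained from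
  the two factors.\<close>

lemma block_perm_eq_comp:
  assumes \<sigma>: "\<sigma> permutes {1..m}" and \<tau>: "\<tau> permutes {1..n}"
  shows "block_perm m \<sigma> \<tau> = \<sigma> \<circ> map_permutation {1..n} ((+) m) \<tau>"
    and "map_permutation {1..n} ((+) m) \<tau> permutes {m+1..m+n}"
proof -
  have "bij_betw ((+) m) {1..n} {m+1..m+n}"
    by (simp add: bij_betw_def add.commute)
  then show perm: "map_permutation {1..n} ((+) m) \<tau> permutes {m+1..m+n}"
    by (rule map_permutation_permutes[OF _ \<tau>])
  show "block_perm m \<sigma> \<tau> = \<sigma> \<circ> map_permutation {1..n} ((+) m) \<tau>"
  proof
    fix j
    show "block_perm m \<sigma> \<tau> j = (\<sigma> \<circ> map_permutation {1..n} ((+) m) \<tau>) j"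
    proof (cases "j \<in> {m+1..m+n}")
      case True
      then have i: "j - m \<in> {1..n}" "m + (j - m) = j" by auto
      have "map_permutation {1..n} ((+) m) \<tau> j = m + \<tau> (j - m)"
        using map_permutation_apply[of "(+) m" "{1..n}" "j - m" \<tau>] i by simp
      \<comment> \<open>Values of \<tau> at positive numbers are positive, so the shifted value
        exceeds \<open>m\<close> and is fixed by \<sigma>.\<close>
      moreover have "\<sigma> (m + \<tau> (j - m)) = m + \<tau> (j - m)"
        using permutes_pos_iff[OF \<tau>, of "j - m"] i by (intro permutes_not_in[OF \<sigma>]) auto
      ultimately show ?thesis using True by (simp add: block_perm_def)
    next
      case False
      then have "j \<le> m \<or> m < j \<and> j - m \<notin> {1..n}" by auto
      then show ?thesis
        using permutes_not_in[OF perm False] permutes_not_in[OF \<sigma>, of j] permutes_not_in[OF \<tau>, of "j - m"]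
        by (auto simp: block_perm_def)
    qed
  qed
qed

lemma block_perm_permutes:
  assumes "\<sigma> permutes {1..m}" "\<tau> permutes {1..n}"
  shows "block_perm m \<sigma> \<tau> permutes {1..m + n}"
  unfolding block_perm_eq_comp(1)[OF assms]
  by (intro permutes_compose permutes_subset[OF block_perm_eq_comp(2)[OF assms]]
      permutes_subset[OF assms(1)]) auto

text \<open>The sign is multiplicative, and transport along an injective map preserves it.\<close>

lemma sign_block_perm:
  assumes "\<sigma> permutes {1..m}" "\<tau> permutes {1..n}"
  shows "sign (block_perm m \<sigma> \<tau>) = sign \<sigma> * sign \<tau>"
proof -
  have "permutation \<sigma>" "permutation (map_permutation {1..n} ((+) m) \<tau>)"
    using assms(1) block_perm_eq_comp(2)[OF assms] by (auto simp: permutation_permutes)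
  moreover have "sign (map_permutation {1..n} ((+) m) \<tau>) = sign \<tau>"
    by (rule sign_map_permutation) (use assms in auto)
  ultimately show ?thesis
    unfolding block_perm_eq_comp(1)[OF assms] by (simp add: sign_compose)
qed

section \<open>The product group and factorization of signed sums\<close>

definition block_group :: "nat \<Rightarrow> (nat \<Rightarrow> nat) set \<Rightarrow> (nat \<Rightarrow> nat) set \<Rightarrow> (nat \<Rightarrow> nat) set" where
  "block_group m H K = (\<lambda>(\<sigma>, \<tau>). block_perm m \<sigma> \<tau>) ` (H \<times> K)"

text \<open>The two components can be recovered from a block permutation, so the block group is
  parametrized bijectively by the pairs in \<open>H \<times> K\<close>.\<close>

lemma sum_block_group:
  assumes H: "balanced_subgroup m H" and K: "balanced_subgroup n K"
  shows "(\<Sum>\<rho>\<in>block_group m H K. F \<rho>) = (\<Sum>\<sigma>\<in>H. \<Sum>\<tau>\<in>K. F (block_perm m \<sigma> \<tau>))"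
proof -
  have "inj_on (\<lambda>(\<sigma>, \<tau>). block_perm m \<sigma> \<tau>) (H \<times> K)"
    by (rule inj_onI)
       (use block_perm_inject balanced_subgroup_permutes[OF H] balanced_subgroup_permutes[OF K] in \<open>clarify, metis\<close>)
  then show ?thesis
    unfolding block_group_def by (simp add: sum.reindex sum.cartesian_product case_prod_unfold)
qed

text \<open>Composition and inversion act on each component separately, which gives the subgroup.
  The sign sum is the product of the sign sums of \<open>H\<close> and \<open>K\<close>, hence
  0.\<close>

lemma balanced_subgroup_block_group:
  assumes H: "balanced_subgroup m H" and K: "balanced_subgroup n K"
  shows "balanced_subgroup (m + n) (block_group m H K)"
  unfolding balanced_subgroup_iff_sum_sign
proof
  note perm = balanced_subgroup_permutes[OF H] balanced_subgroup_permutes[OF K]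
  have sg: "subgroup H (sym_group m)" "subgroup K (sym_group n)"
    using H K by (auto simp: balanced_subgroup_def)
  show "subgroup (block_group m H K) (sym_group (m + n))"
  proof (rule group.subgroupI[OF sym_group_is_group])
    show sub: "block_group m H K \<subseteq> carrier (sym_group (m + n))"
      using block_perm_permutes perm by (auto simp: block_group_def sym_group_carrier)
    show "block_group m H K \<noteq> {}"
      using subgroup.one_closed[OF sg(1)] subgroup.one_closed[OF sg(2)] by (auto simp: block_group_def)
    fix \<rho> assume \<rho>: "\<rho> \<in> block_group m H K"
    then obtain \<sigma> \<tau> where st: "\<sigma> \<in> H" "\<tau> \<in> K" "\<rho> = block_perm m \<sigma> \<tau>"
      by (auto simp: block_group_def)
    have "inv_into UNIV \<sigma> \<in> H" "inv_into UNIV \<tau> \<in> K"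
      using subgroup.m_inv_closed[OF sg(1) st(1)] subgroup.m_inv_closed[OF sg(2) st(2)] perm st
      by (simp_all add: sym_group_carrier)
    then have "inv_into UNIV \<rho> \<in> block_group m H K"
      unfolding st(3) inv_block_perm[OF perm(1)[OF st(1)] perm(2)[OF st(2)]]
      by (auto simp: block_group_def)
    then show "inv\<^bsub>sym_group (m + n)\<^esub> \<rho> \<in> block_group m H K"
      using sub \<rho> by (subst sym_group_inv_equality) auto
    fix \<rho>' assume "\<rho>' \<in> block_group m H K"
    then obtain \<sigma>' \<tau>' where st': "\<sigma>' \<in> H" "\<tau>' \<in> K" "\<rho>' = block_perm m \<sigma>' \<tau>'"
      by (auto simp: block_group_def)
    have "\<sigma> \<circ> \<sigma>' \<in> H" "\<tau> \<circ> \<tau>' \<in> K"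
      using subgroup.m_closed[OF sg(1) st(1) st'(1)] subgroup.m_closed[OF sg(2) st(2) st'(2)]
      by (simp_all add: sym_group_mult)
    then show "\<rho> \<otimes>\<^bsub>sym_group (m + n)\<^esub> \<rho>' \<in> block_group m H K"
      unfolding sym_group_mult st(3) st'(3) block_perm_comp[OF perm(1)[OF st'(1)] perm(2)[OF st'(2)]]
      by (auto simp: block_group_def)
  qed
  have "(\<Sum>\<rho>\<in>block_group m H K. sign \<rho>) = (\<Sum>\<sigma>\<in>H. \<Sum>\<tau>\<in>K. sign \<sigma> * sign \<tau>)"
    unfolding sum_block_group[OF H K] by (intro sum.cong refl sign_block_perm[where n = n] perm)
  also have "\<dots> = 0"
    using H by (simp add: balanced_subgroup_iff_sum_sign flip: sum_product)
  finally show "(\<Sum>\<rho>\<in>block_group m H K. sign \<rho>) = 0" .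
qed

text \<open>The inverse of a block permutation is the block permutation of the inverses, so an entry
  of a block is always fetched from the same block.\<close>

lemma subtuple_permute_block_perm:
  assumes \<sigma>: "\<sigma> permutes {1..m}" and \<tau>: "\<tau> permutes {1..n}"
  shows "subtuple 0 m (permute_tuple (m + n) (block_perm m \<sigma> \<tau>) w) = permute_tuple m \<sigma> (subtuple 0 m w)"
    and "subtuple m n (permute_tuple (m + n) (block_perm m \<sigma> \<tau>) w) = permute_tuple n \<tau> (subtuple m n w)"
  using permutes_inv_atLeastAtMost[OF \<sigma>] permutes_inv_atLeastAtMost[OF \<tau>]
  unfolding permute_tuple_def subtuple_def inv_block_perm[OF assms]
  by (auto simp: block_perm_def intro!: restrict_ext)

text \<open>The sum over the block group is a double sum in which the sign and both indicator
  arguments split, so it is the product of two sums.\<close>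

lemma signed_sum_block_group:
  assumes H: "balanced_subgroup m H" and K: "balanced_subgroup n K"
  shows "signed_sum (m + n) (block_group m H K) (\<lambda>w. I (subtuple 0 m w) * J (subtuple m n w)) w =
     signed_sum m H I (subtuple 0 m w) * signed_sum n K J (subtuple m n w)"
  unfolding signed_sum_def sum_block_group[OF H K] sum_product
proof (intro sum.cong refl)
  fix \<sigma> \<tau> assume "\<sigma> \<in> H" "\<tau> \<in> K"
  then have "\<sigma> permutes {1..m}" "\<tau> permutes {1..n}"
    using balanced_subgroup_permutes H K by blast+
  note * = subtuple_permute_block_perm[OF this] sign_block_perm[OF this]
  show "of_int (sign (block_perm m \<sigma> \<tau>)) *
        (I (subtuple 0 m (permute_tuple (m + n) (block_perm m \<sigma> \<tau>) w)) *
         J (subtuple m n (permute_tuple (m + n) (block_perm m \<sigma> \<tau>) w))) =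
      of_int (sign \<sigma>) * I (permute_tuple m \<sigma> (subtuple 0 m w)) *
      (of_int (sign \<tau>) * J (permute_tuple n \<tau> (subtuple m n w)))"
    unfolding * by simp
qed

section \<open>Independence of the two blocks\<close>

text \<open>The first \<open>m\<close> and the last \<open>n\<close> coordinates of an i.i.d. tuple
  are independent. Boundedness of \<open>F\<close> and \<open>G\<close> provides the integrability
  for Fubini over the disjoint index sets.\<close>

lemma integral_PiM_subtuples:
  fixes F G :: "(nat \<Rightarrow> 'b) \<Rightarrow> real"
  assumes L: "prob_space L"
    and F: "F \<in> borel_measurable (Pi\<^sub>M {1..m} (\<lambda>_. L))" "\<And>z. \<bar>F z\<bar> \<le> B"
    and G: "G \<in> borel_measurable (Pi\<^sub>M {1..n} (\<lambda>_. L))" "\<And>z. \<bar>G z\<bar> \<le> C"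
  shows "(LINT z | Pi\<^sub>M {1..m + n} (\<lambda>_. L). F (subtuple 0 m z) * G (subtuple m n z)) =
     (LINT z | Pi\<^sub>M {1..m} (\<lambda>_. L). F z) * (LINT z | Pi\<^sub>M {1..n} (\<lambda>_. L). G z)"
proof -
  let ?P = "\<lambda>I :: nat set. Pi\<^sub>M I (\<lambda>_. L)" and ?J = "{m + 1..m + n}"
  interpret L: prob_space L by (rule L)
  interpret product_prob_space "\<lambda>_ :: nat. L" by unfold_locales
  interpret Pmn: prob_space "?P {1..m + n}" by (intro prob_space_PiM L)
  have sub: "subtuple k l \<in> measurable (?P I) (?P {1..l})" if "(+) k ` {1..l} \<subseteq> I" for k l I
    unfolding subtuple_def
    by (intro measurable_restrict measurable_component_singleton) (use that in auto)
  have Un: "{1..m} \<union> ?J = {1..m + n}" by auto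
  have int: "integrable (?P ({1..m} \<union> ?J)) (\<lambda>z. F (subtuple 0 m z) * G (subtuple m n z))"
    unfolding Un
  proof (rule Pmn.integrable_const_bound[where B = "B * C"])
    \<comment> \<open>Multiplying the two bounds requires \<open>B\<close> to be nonnegative, which
      holds because it bounds an absolute value.\<close>
    have "0 \<le> B" using F(2) abs_ge_zero by (rule order_trans[rotated])
    then show "AE z in ?P {1..m + n}. norm (F (subtuple 0 m z) * G (subtuple m n z)) \<le> B * C"
      unfolding real_norm_def abs_mult by (intro always_eventually allI mult_mono F G) auto
    show "(\<lambda>z. F (subtuple 0 m z) * G (subtuple m n z)) \<in> borel_measurable (?P {1..m + n})"
      by (intro borel_measurable_times measurable_compose[OF sub F(1)] measurable_compose[OF sub G(1)]) auto
  qed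
  \<comment> \<open>Fubini writes a tuple as the merge of its parts over \<open>{1..m}\<close> and
    \<open>?J\<close>; \<open>F\<close> then sees only \<open>x\<close> and \<open>G\<close> only
    \<open>y\<close>.\<close>
  have "(LINT z | ?P {1..m + n}. F (subtuple 0 m z) * G (subtuple m n z)) =
      (LINT x | ?P {1..m}. LINT y | ?P ?J.
        F (subtuple 0 m (merge {1..m} ?J (x, y))) * G (subtuple m n (merge {1..m} ?J (x, y))))"
    using product_integral_fold[OF _ _ _ int] by (simp only: Un) auto
  also have "\<dots> = (LINT x | ?P {1..m}. LINT y | ?P ?J. F x * G (subtuple m n y))"
  proof (intro Bochner_Integration.integral_cong refl)
    fix x y assume "x \<in> space (?P {1..m})"
    then have "subtuple 0 m (merge {1..m} ?J (x, y)) = x"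
      "subtuple m n (merge {1..m} ?J (x, y)) = subtuple m n y"
      by (auto simp: subtuple_def merge_def space_PiM PiE_iff extensional_def fun_eq_iff)
    then show "F (subtuple 0 m (merge {1..m} ?J (x, y))) * G (subtuple m n (merge {1..m} ?J (x, y))) =
        F x * G (subtuple m n y)" by simp
  qed
  also have "\<dots> = (LINT x | ?P {1..m}. F x) * (LINT y | ?P ?J. G (subtuple m n y))"
    by simp
  also have "(LINT y | ?P ?J. G (subtuple m n y)) = (LINT y | distr (?P ?J) (?P {1..n}) (subtuple m n). G y)"
    by (rule integral_distr[symmetric, OF sub G(1)]) auto
  \<comment> \<open>The shift by \<open>m\<close> maps \<open>{1..n}\<close> injectively into
    \<open>?J\<close>, so reindexing along it gives the product measure over
    \<open>{1..n}\<close>.\<close>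
  also have "distr (?P ?J) (?P {1..n}) (subtuple m n) = ?P {1..n}"
    unfolding subtuple_def by (rule distr_PiM_reindex) (auto intro: L)
  finally show ?thesis .
qed

text \<open>Both signed sums of order \<open>m + n\<close> factor over the blocks. Regrouped, the
  integrand is one function of the first block times one of the second, and these are
  independent.\<close>

lemma src_prod:
  fixes I\<^sub>X J\<^sub>X :: "(nat \<Rightarrow> real ^ 'r::finite) \<Rightarrow> real" and I\<^sub>Y J\<^sub>Y :: "(nat \<Rightarrow> real ^ 's::finite) \<Rightarrow> real"
  assumes I: "rank_indicator m I\<^sub>X" "rank_indicator m I\<^sub>Y" and H: "balanced_subgroup m H"
    and J: "rank_indicator n J\<^sub>X" "rank_indicator n J\<^sub>Y" and K: "balanced_subgroup n K"
    and L: "prob_space L" "sets L = sets borel"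
  shows "src (m + n) (\<lambda>w. I\<^sub>X (subtuple 0 m w) * J\<^sub>X (subtuple m n w))
      (\<lambda>w. I\<^sub>Y (subtuple 0 m w) * J\<^sub>Y (subtuple m n w)) (block_group m H K) L =
    src m I\<^sub>X I\<^sub>Y H L * src n J\<^sub>X J\<^sub>Y K L"
proof -
  have le: "0 + m \<le> m + n" "m + n \<le> m + n" by auto
  have "src_integrand (m + n) (\<lambda>w. I\<^sub>X (subtuple 0 m w) * J\<^sub>X (subtuple m n w))
      (\<lambda>w. I\<^sub>Y (subtuple 0 m w) * J\<^sub>Y (subtuple m n w)) (block_group m H K) =
      (\<lambda>z. src_integrand m I\<^sub>X I\<^sub>Y H (subtuple 0 m z) * src_integrand n J\<^sub>X J\<^sub>Y K (subtuple m n z))"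
    unfolding src_integrand_def fun_eq_iff
    by (intro allI) (simp only: signed_sum_block_group[OF H K] map_subtuple[OF le(1)] map_subtuple[OF le(2)] mult_ac)
  then show ?thesis
    unfolding src_eq_integral
    using integral_PiM_subtuples[OF L(1) src_integrand_measurable[OF I H L(2)] abs_src_integrand_le[OF I]
        src_integrand_measurable[OF J K L(2)] abs_src_integrand_le[OF J]]
    by (simp only:)
qed

theorem proposition3p7:
  fixes \<mu> :: "((real ^ 'r::finite) \<times> (real ^ 's::finite)) measure \<Rightarrow> real"
  assumes "symmetric_rank_covariance \<mu>"
  shows
    "(\<forall>(M :: 'a measure) (X :: 'a \<Rightarrow> real ^ 'r) (Y :: 'a \<Rightarrow> real ^ 's)
        (f :: 'r \<Rightarrow> real \<Rightarrow> real) (g :: 's \<Rightarrow> real \<Rightarrow> real).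
        prob_space M \<and> X \<in> borel_measurable M \<and> Y \<in> borel_measurable M \<and>
        (\<forall>i. strict_mono (f i)) \<and> (\<forall>i. strict_mono (g i)) \<longrightarrow>
        \<mu> (joint_law M X Y) =
        \<mu> (joint_law M (\<lambda>\<omega>. \<chi> i. f i (X \<omega> $ i)) (\<lambda>\<omega>. \<chi> i. g i (Y \<omega> $ i))))
     \<and>
     (\<forall>(M :: 'a measure) (X :: 'a \<Rightarrow> real ^ 'r) (Y :: 'a \<Rightarrow> real ^ 's).
        prob_space M \<and> X \<in> borel_measurable M \<and> Y \<in> borel_measurable M \<and>
        indep_vectors M X Y \<longrightarrow>
        \<mu> (joint_law M X Y) = 0)
     \<and>
     (\<forall>\<nu> :: ((real ^ 'r) \<times> (real ^ 's)) measure \<Rightarrow> real.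
        symmetric_rank_covariance \<nu> \<longrightarrow> symmetric_rank_covariance (\<lambda>L. \<mu> L * \<nu> L))"
proof -
  obtain c m I\<^sub>X I\<^sub>Y H where c: "c > 0" and I: "rank_indicator m I\<^sub>X" "rank_indicator m I\<^sub>Y"
    and H: "balanced_subgroup m H"
    and \<mu>: "\<And>L. prob_space L \<Longrightarrow> sets L = sets borel \<Longrightarrow> \<mu> L = c * src m I\<^sub>X I\<^sub>Y H L"
    using assms unfolding symmetric_rank_covariance_def by blast
  have XY: "(\<lambda>\<omega>. (X \<omega>, Y \<omega>)) \<in> borel_measurable M"
    if "X \<in> borel_measurable M" "Y \<in> borel_measurable M"
    for M :: "'a measure" and X :: "'a \<Rightarrow> real ^ 'r" and Y :: "'a \<Rightarrow> real ^ 's"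
    unfolding borel_prod[symmetric] using that by (rule measurable_Pair)
  \<comment> \<open>The representation of \<mu> is given only at Borel probability measures, so the
    laws are first shown to be such.\<close>
  have law: "prob_space (joint_law M X Y)" "sets (joint_law M X Y) = sets borel"
    if "prob_space M" "X \<in> borel_measurable M" "Y \<in> borel_measurable M"
    for M :: "'a measure" and X :: "'a \<Rightarrow> real ^ 'r" and Y :: "'a \<Rightarrow> real ^ 's"
    using that by (auto simp: joint_law_def intro!: prob_space.prob_space_distr XY)
  show ?thesis
  proof (intro conjI allI impI; (elim conjE)?)
    fix M :: "'a measure" and X :: "'a \<Rightarrow> real ^ 'r" and Y :: "'a \<Rightarrow> real ^ 's"
      and f :: "'r \<Rightarrow> real \<Rightarrow> real" and g :: "'s \<Rightarrow> real \<Rightarrow> real"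
    assume M: "prob_space M" and X: "X \<in> borel_measurable M" and Y: "Y \<in> borel_measurable M"
      and "\<forall>i. strict_mono (f i)" "\<forall>i. strict_mono (g i)"
    then have f: "\<And>i. strict_mono (f i)" and g: "\<And>i. strict_mono (g i)" by auto
    let ?T = "\<lambda>z. (\<chi> i. f i (fst z $ i), \<chi> i. g i (snd z $ i))"
    let ?L = "joint_law M X Y"
      and ?L' = "joint_law M (\<lambda>\<omega>. \<chi> i. f i (X \<omega> $ i)) (\<lambda>\<omega>. \<chi> i. g i (Y \<omega> $ i))"
    note T = src_strict_mono[OF I H law[OF M X Y] f g]
    \<comment> \<open>The law of the transformed pair is the push-forward of the original law under
      \<open>?T\<close>, so invariance of \<open>src\<close> applies.\<close>
    have "?L' = distr ?L borel ?T"
      using T(1) unfolding joint_law_def by (subst distr_distr[OF _ XY[OF X Y]]) (auto simp: comp_def)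
    moreover from this have "prob_space ?L'" "sets ?L' = sets borel"
      using prob_space.prob_space_distr[OF law(1)[OF M X Y] T(1)] by auto
    ultimately show "\<mu> ?L = \<mu> ?L'"
      using \<mu> law[OF M X Y] T(2) by simp
  next
    fix M :: "'a measure" and X :: "'a \<Rightarrow> real ^ 'r" and Y :: "'a \<Rightarrow> real ^ 's"
    assume M: "prob_space M" and X: "X \<in> borel_measurable M" and Y: "Y \<in> borel_measurable M"
      and ind: "indep_vectors M X Y"
    have "src m I\<^sub>X I\<^sub>Y H (joint_law M X Y) = 0"
      unfolding joint_law_indep[OF M X Y ind]
      by (rule src_pair_measure[OF I H]) (auto intro: prob_space.prob_space_distr M X Y)
    then show "\<mu> (joint_law M X Y) = 0"
      using \<mu> law[OF M X Y] by simp
  next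
    fix \<nu> :: "((real ^ 'r) \<times> (real ^ 's)) measure \<Rightarrow> real"
    assume "symmetric_rank_covariance \<nu>"
    then obtain d n J\<^sub>X J\<^sub>Y K where d: "d > 0" and J: "rank_indicator n J\<^sub>X" "rank_indicator n J\<^sub>Y"
      and K: "balanced_subgroup n K"
      and \<nu>: "\<And>L. prob_space L \<Longrightarrow> sets L = sets borel \<Longrightarrow> \<nu> L = d * src n J\<^sub>X J\<^sub>Y K L"
      unfolding symmetric_rank_covariance_def by blast
    show "symmetric_rank_covariance (\<lambda>L. \<mu> L * \<nu> L)"
      unfolding symmetric_rank_covariance_def
    proof (intro exI conjI allI impI)
      show "c * d > 0" using c d by simp
      show "rank_indicator (m + n) (\<lambda>w. I\<^sub>X (subtuple 0 m w) * J\<^sub>X (subtuple m n w))"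
        "rank_indicator (m + n) (\<lambda>w. I\<^sub>Y (subtuple 0 m w) * J\<^sub>Y (subtuple m n w))"
        by (intro rank_indicator_prod I J)+
      show "balanced_subgroup (m + n) (block_group m H K)"
        by (rule balanced_subgroup_block_group[OF H K])
      fix L :: "((real ^ 'r) \<times> (real ^ 's)) measure"
      assume "prob_space L \<and> sets L = sets borel"
      then show "\<mu> L * \<nu> L = c * d * src (m + n) (\<lambda>w. I\<^sub>X (subtuple 0 m w) * J\<^sub>X (subtuple m n w))
          (\<lambda>w. I\<^sub>Y (subtuple 0 m w) * J\<^sub>Y (subtuple m n w)) (block_group m H K) L"
        using \<mu> \<nu> by (simp add: src_prod[OF I H J K])
    qed
  qed
qed

end
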